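(* Let $s\in\mathbb N$ and let $\mathcal H=\{X_1,\dots,X_m\}$ be a family of vector fields on $\mathbb R^n$ in the regularity class $C^{s-1,1}_{\mathcal H,\mathrm{loc}}\cap C^1$. For any $\ell\in\{2,\dots,s\}$ and $1\le p\le\ell-1$, we have $$\sum_{\sigma\in\mathfrak S_\ell}\pi_\ell(\sigma)\sum_{1\le i_1<\cdots<i_p\le\ell}X_{\sigma_{i_p}^{b_p}(v)\cdots\sigma_{i_2}^{b_2}(v)\,\sigma_{i_1}^{b_1}(v)\,w}=0$$ for all $b_1,\dots,b_p\in\mathbb N\cup\{0\}$, all words $w$ with $|w|\ge0$ and all words $v$ with $|v|=\ell$, such that $1\le b_1+\cdots+b_p\le s-|w|$.
   Context: Write $X_j=f_j\cdot\nabla$ with $f_j:\mathbb R^n\to\mathbb R^n$; $e^{tX}x$ is the (local) flow of a $C^1$ vector field. Lie derivative: $X^\sharp g(x):=\lim_{t\to0}\frac1t(g(e^{tX}x)-g(x))$ (componentwise for vector valued $g$). Regularity class: let $d(x,y):=\inf\{r>0:\ y=e^{t_1Z_1}\cdots e^{t_\mu Z_\mu}x$ for some $\mu\in\mathbb N$, $\sum_j|t_j|\le1$, $Z_j\in\{rX_1,\dots,rX_m\}\}$ ($=+\infty$ if there are none). $g$ is $d$-Lipschitz on $A$ if $\sup_{x\neq y\in A}|g(x)-g(y)|/d(x,y)<\infty$. $g\in C^{k,1}_{\mathcal H,\mathrm{loc}}$ means that all derivatives $X_{j_1}^\sharp\cdots X_{j_k}^\sharp g$ exist and are $d$-Lipschitz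 on each Euclidean-bounded set. A vector field is in a class if its coefficients are. $C^1$ is Euclidean $C^1$. Commutators: a word $w=w_1\cdots w_\ell$ has letters in $\{1,\dots,m\}$ and length $|w|=\ell$; juxtaposition is concatenation, a letter with exponent $b$ is that letter repeated $b$ times (absent if $b=0$), and $|w|=0$ means the empty word, in which case $X_{vw}=X_v$. For $\sigma\in\mathfrak S_\ell$ put $\sigma_i(v):=v_{\sigma(i)}$, and $\sigma_i^b(v):=(\sigma_i(v))^b$. Define $\pi_\ell:\mathfrak S_\ell\to\{-1,0,1\}$ by $\pi_1=1$ and, for $\tau\in\mathfrak S_{\ell+1}$: if $\tau(1)=1$ then $\pi_{\ell+1}(\tau)=\pi_\ell(\sigma)$ with $\sigma(i)=\tau(i+1)-1$; if $\tau(\ell+1)=1$ then $\pi_{\ell+1}(\tau)=-\pi_\ell(\sigma)$ with $\sigma(i)=\tau(i)-1$; otherwise $\pi_{\ell+1}(\tau)=0$. For a word $u$ of length $k$, $1\le k\le s$, $f_u:=\sum_{\sigma\in\mathfrak S_k}\pi_k(\sigma)X^\sharp_{\sigma_1(u)}\cdots X^\sharp_{\sigma_{k-1}(u)}f_{\sigma_k(u)}$ and $X_u:=f_u\cdot\nabla$ (nested commutator $[X_{u_1},\dots,[X_{u_{k-1}},X_{u_k}]]$). *)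

theory Defs
  imports "HOL-Analysis.Analysis" "HOL-Combinatorics.Permutations"
begin

text \<open>A vector field \<open>X = f \<cdot> \<nabla>\<close> on \<open>\<real>\<^sup>n\<close> is represented by its coefficient map
  \<open>f :: real^'n \<Rightarrow> real^'n\<close>; a family \<open>X\<^sub>1, \<dots>, X\<^sub>m\<close> by \<open>m\<close> and \<open>f :: nat \<Rightarrow> real^'n \<Rightarrow> real^'n\<close>,
  of which only the values at \<open>1, \<dots>, m\<close> matter.\<close>

text \<open>\<open>flows_to X t x y\<close>: the local flow \<open>e\<^bsup>tX\<^esup>x\<close> is defined and equal to \<open>y\<close>
  (\<open>t\<close> may be negative).\<close>

definition flows_to :: "(real^'n \<Rightarrow> real^'n) \<Rightarrow> real \<Rightarrow> real^'n \<Rightarrow> real^'n \<Rightarrow> bool" where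
  "flows_to X t x y \<longleftrightarrow>
     (\<exists>\<gamma>. \<gamma> 0 = x \<and> \<gamma> t = y \<and>
       (\<forall>\<tau>\<in>closed_segment 0 t.
          (\<gamma> has_vector_derivative X (\<gamma> \<tau>)) (at \<tau> within closed_segment 0 t)))"

definition flow :: "(real^'n \<Rightarrow> real^'n) \<Rightarrow> real \<Rightarrow> real^'n \<Rightarrow> real^'n" where
  "flow X t x = (THE y. flows_to X t x y)"

definition has_lie_derivative ::
    "(real^'n \<Rightarrow> real^'n) \<Rightarrow> (real^'n \<Rightarrow> 'b::real_normed_vector) \<Rightarrow> 'b \<Rightarrow> real^'n \<Rightarrow> bool" where
  "has_lie_derivative X g L x \<longleftrightarrow>
     ((\<lambda>t. (1 / t) *\<^sub>R (g (flow X t x) - g x)) \<longlongrightarrow> L) (at 0)"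

definition lie_derivative ::
    "(real^'n \<Rightarrow> real^'n) \<Rightarrow> (real^'n \<Rightarrow> 'b::real_normed_vector) \<Rightarrow> real^'n \<Rightarrow> 'b" where
  "lie_derivative X g x = (THE L. has_lie_derivative X g L x)"

text \<open>The iterated derivative \<open>X\<^sup>\<sharp>\<^bsub>j1\<^esub> \<cdots> X\<^sup>\<sharp>\<^bsub>jk\<^esub> g\<close> along the list \<open>[j1, \<dots>, jk]\<close>, and its existence
  on \<open>\<real>\<^sup>n\<close> (which includes the existence of the inner ones).\<close>

primrec iter_lie ::
    "(nat \<Rightarrow> real^'n \<Rightarrow> real^'n) \<Rightarrow> nat list \<Rightarrow> (real^'n \<Rightarrow> 'b::real_normed_vector) \<Rightarrow> real^'n \<Rightarrow> 'b" where
  "iter_lie f [] g = g"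
| "iter_lie f (j # js) g = lie_derivative (f j) (iter_lie f js g)"

primrec iter_lie_exists ::
    "(nat \<Rightarrow> real^'n \<Rightarrow> real^'n) \<Rightarrow> nat list \<Rightarrow> (real^'n \<Rightarrow> 'b::real_normed_vector) \<Rightarrow> bool" where
  "iter_lie_exists f [] g \<longleftrightarrow> True"
| "iter_lie_exists f (j # js) g \<longleftrightarrow>
     iter_lie_exists f js g \<and> (\<forall>x. \<exists>L. has_lie_derivative (f j) (iter_lie f js g) L x)"

text \<open>\<open>flow_chain [(t\<^sub>1, Z\<^sub>1), \<dots>, (t\<^sub>\<mu>, Z\<^sub>\<mu>)] x y\<close>: \<open>y = e\<^bsup>t1 Z1\<^esup> \<cdots> e\<^bsup>t\<mu> Z\<mu>\<^esup> x\<close>, the last flow acting first.\<close>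

primrec flow_chain ::
    "(real \<times> (real^'n \<Rightarrow> real^'n)) list \<Rightarrow> real^'n \<Rightarrow> real^'n \<Rightarrow> bool" where
  "flow_chain [] x y \<longleftrightarrow> y = x"
| "flow_chain (tZ # ps) x y \<longleftrightarrow> (\<exists>z. flow_chain ps x z \<and> flows_to (snd tZ) (fst tZ) z y)"

definition cc_dist ::
    "nat \<Rightarrow> (nat \<Rightarrow> real^'n \<Rightarrow> real^'n) \<Rightarrow> real^'n \<Rightarrow> real^'n \<Rightarrow> ennreal" where
  "cc_dist m f x y =
     (INF r \<in> {r::real. r > 0 \<and>
        (\<exists>ps. ps \<noteq> [] \<and> flow_chain ps x y \<and> (\<Sum>tZ\<leftarrow>ps. \<bar>fst tZ\<bar>) \<le> 1 \<and>
              snd ` set ps \<subseteq> (\<lambda>j z. r *\<^sub>R f j z) ` {1..m})}. ennreal r)"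

text \<open>In \<open>ennreal\<close>, a finite number divided by \<open>\<infinity>\<close> is \<open>0\<close>.\<close>

definition d_lipschitz_on ::
    "nat \<Rightarrow> (nat \<Rightarrow> real^'n \<Rightarrow> real^'n) \<Rightarrow> (real^'n) set \<Rightarrow> (real^'n \<Rightarrow> 'b::real_normed_vector) \<Rightarrow> bool" where
  "d_lipschitz_on m f A g \<longleftrightarrow>
     (SUP (x, y) \<in> {(x, y). x \<in> A \<and> y \<in> A \<and> x \<noteq> y}.
        ennreal (norm (g x - g y)) / cc_dist m f x y) < \<infinity>"

definition words :: "nat \<Rightarrow> nat list set" where
  "words m = lists {1..m}"

definition C_k1_loc ::
    "nat \<Rightarrow> (nat \<Rightarrow> real^'n \<Rightarrow> real^'n) \<Rightarrow> nat \<Rightarrow> (real^'n \<Rightarrow> 'b::real_normed_vector) \<Rightarrow> bool" where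
  "C_k1_loc m f k g \<longleftrightarrow>
     (\<forall>js\<in>words m. length js = k \<longrightarrow>
        iter_lie_exists f js g \<and> (\<forall>A. bounded A \<longrightarrow> d_lipschitz_on m f A (iter_lie f js g)))"

definition C1 :: "(real^'n \<Rightarrow> real^'n) \<Rightarrow> bool" where
  "C1 g \<longleftrightarrow> (\<exists>g' :: real^'n \<Rightarrow> ((real^'n) \<Rightarrow>\<^sub>L (real^'n)).
     (\<forall>x. (g has_derivative blinfun_apply (g' x)) (at x)) \<and> continuous_on UNIV g')"

text \<open>A permutation in \<open>\<SS>\<^sub>k\<close> is a function with \<open>\<sigma> permutes {1..k}\<close>; the two reduced permutations
  in \<open>perm_coeff\<close> are accordingly extended by the identity outside \<open>{1..k}\<close>. The value at index \<open>0\<close> is a dummy.\<close>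

fun perm_coeff :: "nat \<Rightarrow> (nat \<Rightarrow> nat) \<Rightarrow> int" where
  "perm_coeff 0 \<sigma> = 0"
| "perm_coeff (Suc 0) \<sigma> = 1"
| "perm_coeff (Suc (Suc k)) \<tau> =
     (if \<tau> 1 = 1 then perm_coeff (Suc k) (\<lambda>i. if i \<in> {1..Suc k} then \<tau> (i + 1) - 1 else i)
      else if \<tau> (Suc (Suc k)) = 1 then - perm_coeff (Suc k) (\<lambda>i. if i \<in> {1..Suc k} then \<tau> i - 1 else i)
      else 0)"

text \<open>\<open>\<sigma>\<^sub>i(v) = v\<^bsub>\<sigma>(i)\<^esub>\<close>, with letters numbered from \<open>1\<close>.\<close>

definition perm_letter :: "(nat \<Rightarrow> nat) \<Rightarrow> nat list \<Rightarrow> nat \<Rightarrow> nat" where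
  "perm_letter \<sigma> v i = v ! (\<sigma> i - 1)"

text \<open>The coefficient map \<open>f\<^sub>u\<close> of the nested commutator \<open>X\<^sub>u\<close>, for a nonempty word \<open>u\<close>.\<close>

definition commutator ::
    "(nat \<Rightarrow> real^'n \<Rightarrow> real^'n) \<Rightarrow> nat list \<Rightarrow> real^'n \<Rightarrow> real^'n" where
  "commutator f u x =
     (\<Sum>\<sigma> | \<sigma> permutes {1..length u}.
        of_int (perm_coeff (length u) \<sigma>) *\<^sub>R
        iter_lie f (map (perm_letter \<sigma> u) [1..<length u]) (f (perm_letter \<sigma> u (length u))) x)"

text \<open>\<open>power_word \<sigma> v b i p\<close> is \<open>\<sigma>\<^bsub>i p\<^esub>(v)\<^bsup>b p\<^esup> \<cdots> \<sigma>\<^bsub>i 2\<^esub>(v)\<^bsup>b 2\<^esup> \<sigma>\<^bsub>i 1\<^esub>(v)\<^bsup>b 1\<^esup>\<close>.\<close>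

primrec power_word ::
    "(nat \<Rightarrow> nat) \<Rightarrow> nat list \<Rightarrow> (nat \<Rightarrow> nat) \<Rightarrow> (nat \<Rightarrow> nat) \<Rightarrow> nat \<Rightarrow> nat list" where
  "power_word \<sigma> v b i 0 = []"
| "power_word \<sigma> v b i (Suc p) =
     replicate (b (Suc p)) (perm_letter \<sigma> v (i (Suc p))) @ power_word \<sigma> v b i p"

text \<open>Index choices \<open>1 \<le> i 1 < \<cdots> < i p \<le> l\<close>.\<close>

definition incr_indices :: "nat \<Rightarrow> nat \<Rightarrow> (nat \<Rightarrow> nat) set" where
  "incr_indices p l = {i \<in> {1..p} \<rightarrow>\<^sub>E {1..l}. strict_mono_on {1..p} i}"

end

theory Submission
  imports Defs
begin

text \<open>Only the nested-commutator structure of the coefficients \<open>\<pi>\<^sub>l\<close> matters: for an arbitrary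
  function \<open>G\<close> of \<open>p < l\<close> letters, the signed sum over \<open>\<sigma>\<close> of \<open>G\<close> over all \<open>p\<close>-letter subwords of
  \<open>\<sigma>(1) \<cdots> \<sigma>(l)\<close> vanishes when \<open>l \<ge> 2\<close>. This is the formal counterpart of
  \<open>[1 + y\<^sub>1, [1 + y\<^sub>2, \<dots>]] = [y\<^sub>1, [y\<^sub>2, \<dots>]]\<close>: the right-hand side has no terms of degree below \<open>l\<close>.
  By the recursion for \<open>\<pi>\<^sub>l\<close>, the permuted words are \<open>1 u\<close> with sign \<open>+\<close> and \<open>u 1\<close> with sign \<open>-\<close>.
  The subwords that avoid the letter \<open>1\<close> cancel, and those that contain it reduce to
  subwords of \<open>u\<close> with \<open>p - 1\<close> letters, so that induction on \<open>l\<close> applies.\<close>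

section \<open>Sums over subwords\<close>

text \<open>Subwords are counted by position, so repeated letters give repeated terms. The last
  clause separates the choices that use the position of \<open>x\<close> from those that skip
  it.\<close>

fun subword_sum :: "'a list \<Rightarrow> nat \<Rightarrow> ('a list \<Rightarrow> 'b::comm_monoid_add) \<Rightarrow> 'b" where
  "subword_sum xs 0 G = G []"
| "subword_sum [] (Suc p) G = 0"
| "subword_sum (x # xs) (Suc p) G = subword_sum xs p (\<lambda>ys. G (x # ys)) + subword_sum xs (Suc p) G"

text \<open>The same split at the right end. It serves the words \<open>u 1\<close> in the recursion
  for the commutator, and index tuples whose range grows at the top.\<close>

lemma subword_sum_snoc:
  "subword_sum (xs @ [x]) (Suc p) G = subword_sum xs p (\<lambda>ys. G (ys @ [x])) + subword_sum xs (Suc p) G"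
proof (induction xs arbitrary: p G)
  case Nil
  then show ?case by (cases p) simp_all
next
  case (Cons y xs)
  then show ?case by (cases p) (simp_all add: add_ac)
qed

lemma subword_sum_map:
  "subword_sum (map h xs) p G = subword_sum xs p (\<lambda>ys. G (map h ys))"
proof (induction xs arbitrary: p G)
  case Nil
  then show ?case by (cases p) simp_all
next
  case (Cons y xs)
  then show ?case by (cases p) simp_all
qed

section \<open>Increasing index tuples as subwords\<close>

lemma finite_incr_indices: "finite (incr_indices p l)"
proof -
  have "finite ({1..p} \<rightarrow>\<^sub>E {1..l})" by (intro finite_PiE) auto
  then show ?thesis
    unfolding incr_indices_def by (rule rev_finite_subset) blast
qed

lemma incr_indices_0: "incr_indices 0 l = {\<lambda>_. undefined}"
  by (auto simp: incr_indices_def strict_mono_on_def)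

lemma incr_indices_Suc_0: "incr_indices (Suc p) 0 = {}"
  by (auto simp: incr_indices_def PiE_def Pi_def)

text \<open>By monotonicity only the last entry can equal \<open>Suc l\<close>; the two sets
  correspond to whether it does.\<close>

lemma incr_indices_Suc_Suc:
  "incr_indices (Suc p) (Suc l)
     = (\<lambda>i. i(Suc p := Suc l)) ` incr_indices p l \<union> incr_indices (Suc p) l" (is "?L = ?A \<union> ?B")
proof (intro equalityI subsetI)
  fix i assume i: "i \<in> ?L"
  then have ran: "\<And>k. k \<in> {1..Suc p} \<Longrightarrow> i k \<in> {1..Suc l}"
    and ext: "\<And>k. k \<notin> {1..Suc p} \<Longrightarrow> i k = undefined"
    and mono: "\<And>j k. j \<in> {1..Suc p} \<Longrightarrow> k \<in> {1..Suc p} \<Longrightarrow> j < k \<Longrightarrow> i j < i k"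
    by (auto simp: incr_indices_def strict_mono_on_def PiE_def extensional_def)
  have below: "i k \<in> {1..l}" if "k \<in> {1..p}" for k
    using mono[of k "Suc p"] ran[of k] ran[of "Suc p"] that by auto
  show "i \<in> ?A \<union> ?B"
  proof (cases "i (Suc p) = Suc l")
    case True
    \<comment> \<open>Tuples in \<open>incr_indices p l\<close> are extensional, so the removed
      entry must be reset to \<open>undefined\<close>.\<close>
    let ?i = "i(Suc p := undefined)"
    have "?i \<in> incr_indices p l"
      using below ext mono by (auto simp: incr_indices_def strict_mono_on_def PiE_def extensional_def)
    moreover have "i = ?i(Suc p := Suc l)" using True by auto
    ultimately show ?thesis by blast
  next
    case False
    then have "i k \<in> {1..l}" if "k \<in> {1..Suc p}" for k
      using below[of k] ran[of k] that by (cases "k = Suc p") auto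
    then have "i \<in> ?B"
      using ext mono by (auto simp: incr_indices_def strict_mono_on_def PiE_def extensional_def)
    then show ?thesis ..
  qed
next
  fix i assume "i \<in> ?A \<union> ?B"
  then show "i \<in> ?L"
  proof
    assume "i \<in> ?A"
    then obtain j where j: "j \<in> incr_indices p l" "i = j(Suc p := Suc l)" by blast
    have "\<And>k. k \<in> {1..p} \<Longrightarrow> j k \<in> {1..l}"
      using j(1) by (auto simp: incr_indices_def)
    then have "\<And>k. k \<in> {1..p} \<Longrightarrow> 1 \<le> j k \<and> j k \<le> l" by auto
    with j show ?thesis
      by (auto simp: incr_indices_def strict_mono_on_def PiE_def extensional_def le_Suc_eq less_Suc_eq_le)
  next
    assume "i \<in> ?B"
    moreover have "({1..Suc p} \<rightarrow>\<^sub>E {1..l}) \<subseteq> ({1..Suc p} \<rightarrow>\<^sub>E {1..Suc l})"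
      by (intro PiE_mono) simp
    ultimately show ?thesis unfolding incr_indices_def by blast
  qed
qed

text \<open>Induction on \<open>l\<close> with \<open>p\<close> and \<open>G\<close> arbitrary: the
  split by the last index on the left matches the split by the last letter on the right.\<close>

lemma sum_incr_indices:
  "(\<Sum>i\<in>incr_indices p l. G (map (\<lambda>k. \<sigma> (i k)) [1..<Suc p]))
     = subword_sum (map \<sigma> [1..<Suc l]) p G"
proof (induction l arbitrary: p G)
  case 0
  show ?case by (cases p) (simp_all add: incr_indices_0 incr_indices_Suc_0)
next
  case (Suc l)
  show ?case
  proof (cases p)
    case 0
    then show ?thesis by (simp add: incr_indices_0)
  next
    case (Suc q)
    let ?e = "\<lambda>i. i(Suc q := Suc l)" and ?F = "\<lambda>i. G (map (\<lambda>k. \<sigma> (i k)) [1..<Suc (Suc q)])"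
    have inj: "inj_on ?e (incr_indices q l)"
    proof (rule inj_onI)
      fix i j assume ij: "i \<in> incr_indices q l" "j \<in> incr_indices q l" "?e i = ?e j"
      then have "i (Suc q) = undefined" "j (Suc q) = undefined"
        by (auto simp: incr_indices_def PiE_def extensional_def)
      with ij(3) show "i = j" by (metis fun_upd_triv fun_upd_upd)
    qed
    have disj: "?e ` incr_indices q l \<inter> incr_indices (Suc q) l = {}"
      by (auto simp: incr_indices_def dest!: PiE_mem[where x = "Suc q"])
    have "(\<Sum>i\<in>incr_indices (Suc q) (Suc l). ?F i)
        = (\<Sum>i\<in>incr_indices q l. ?F (?e i)) + (\<Sum>i\<in>incr_indices (Suc q) l. ?F i)"
      unfolding incr_indices_Suc_Suc
      by (simp only: sum.union_disjoint[OF finite_imageI[OF finite_incr_indices] finite_incr_indices disj]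
          sum.reindex[OF inj] o_def)
    \<comment> \<open>The update affects only position \<open>Suc q\<close>, so it appends the fixed
      letter \<open>\<sigma> (Suc l)\<close>, which is absorbed into the function of the remaining
      letters.\<close>
    also have "(\<Sum>i\<in>incr_indices q l. ?F (?e i))
        = (\<Sum>i\<in>incr_indices q l. (\<lambda>ys. G (ys @ [\<sigma> (Suc l)])) (map (\<lambda>k. \<sigma> (i k)) [1..<Suc q]))"
      by (intro sum.cong refl arg_cong[where f = G]) simp
    also have "\<dots> = subword_sum (map \<sigma> [1..<Suc l]) q (\<lambda>ys. G (ys @ [\<sigma> (Suc l)]))"
      by (rule Suc.IH)
    also have "(\<Sum>i\<in>incr_indices (Suc q) l. ?F i) = subword_sum (map \<sigma> [1..<Suc l]) (Suc q) G"
      by (rule Suc.IH)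
    finally show ?thesis
      using subword_sum_snoc[of "map \<sigma> [1..<Suc l]" "\<sigma> (Suc l)" q G] Suc by simp
  qed
qed

section \<open>Permutations with the value 1 at an end\<close>

lemma permutes_intervalI:
  fixes \<sigma> :: "nat \<Rightarrow> nat"
  assumes "\<And>i. i \<in> {1..n} \<Longrightarrow> \<sigma> i \<in> {1..n}" "inj_on \<sigma> {1..n}" "\<And>i. i \<notin> {1..n} \<Longrightarrow> \<sigma> i = i"
  shows "\<sigma> permutes {1..n}"
proof (rule bij_imp_permutes)
  have "\<sigma> ` {1..n} = {1..n}"
    using assms(1,2) by (intro endo_inj_surj) auto
  with assms(2) show "bij_betw \<sigma> {1..n} {1..n}" by (simp add: bij_betw_def)
qed (rule assms(3))

text \<open>In one-line notation, \<open>perm_cons\<close> and \<open>perm_snoc\<close> raise all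
  values of a permutation by one and put the value 1 at the left or right end. They invert
  \<open>perm_tail\<close> and \<open>perm_init\<close>, which are the two reductions in
  \<open>perm_coeff\<close>.\<close>

definition perm_cons :: "nat \<Rightarrow> (nat \<Rightarrow> nat) \<Rightarrow> nat \<Rightarrow> nat" where
  "perm_cons n \<sigma> j = (if j = 1 then 1 else if j \<in> {2..Suc n} then Suc (\<sigma> (j - 1)) else j)"

definition perm_snoc :: "nat \<Rightarrow> (nat \<Rightarrow> nat) \<Rightarrow> nat \<Rightarrow> nat" where
  "perm_snoc n \<sigma> j = (if j = Suc n then 1 else if j \<in> {1..n} then Suc (\<sigma> j) else j)"

definition perm_tail :: "nat \<Rightarrow> (nat \<Rightarrow> nat) \<Rightarrow> nat \<Rightarrow> nat" where
  "perm_tail n \<tau> = (\<lambda>i. if i \<in> {1..n} then \<tau> (i + 1) - 1 else i)"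

definition perm_init :: "nat \<Rightarrow> (nat \<Rightarrow> nat) \<Rightarrow> nat \<Rightarrow> nat" where
  "perm_init n \<tau> = (\<lambda>i. if i \<in> {1..n} then \<tau> i - 1 else i)"

lemma permutes_interval_in: "\<sigma> permutes {1..n} \<Longrightarrow> i \<in> {1..n} \<Longrightarrow> 1 \<le> \<sigma> i \<and> \<sigma> i \<le> (n::nat)"
  using permutes_in_image[of \<sigma> "{1..n}" i] by auto

lemma permutes_perm_cons:
  assumes "\<sigma> permutes {1..n}"
  shows "perm_cons n \<sigma> permutes {1..Suc n}"
proof (rule permutes_intervalI)
  show "perm_cons n \<sigma> i \<in> {1..Suc n}" if "i \<in> {1..Suc n}" for i
    using permutes_interval_in[OF assms, of "i - 1"] that
    by (cases "i = 1") (simp_all add: perm_cons_def, linarith)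
  show "inj_on (perm_cons n \<sigma>) {1..Suc n}"
  proof (rule inj_onI)
    fix i j assume ij: "i \<in> {1..Suc n}" "j \<in> {1..Suc n}" "perm_cons n \<sigma> i = perm_cons n \<sigma> j"
    have ne1: "perm_cons n \<sigma> k \<noteq> 1" if "k \<in> {1..Suc n}" "k \<noteq> 1" for k
      using permutes_interval_in[OF assms, of "k - 1"] that by (simp add: perm_cons_def) linarith
    have one: "perm_cons n \<sigma> 1 = 1" by (simp add: perm_cons_def)
    show "i = j"
    proof (cases "i = 1 \<or> j = 1")
      case True
      then show ?thesis
        using ij one ne1[of i] ne1[of j] by metis
    next
      case False
      then have "\<sigma> (i - 1) = \<sigma> (j - 1)"
        using ij by (simp add: perm_cons_def)
      then have "i - 1 = j - 1" by (rule injD[OF permutes_inj[OF assms]])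
      then show ?thesis using ij(1,2) by simp linarith
    qed
  qed
qed (auto simp: perm_cons_def)

lemma permutes_perm_snoc:
  assumes "\<sigma> permutes {1..n}"
  shows "perm_snoc n \<sigma> permutes {1..Suc n}"
proof (rule permutes_intervalI)
  show "perm_snoc n \<sigma> i \<in> {1..Suc n}" if "i \<in> {1..Suc n}" for i
    using permutes_interval_in[OF assms, of i] that by (auto simp: perm_snoc_def)
  show "inj_on (perm_snoc n \<sigma>) {1..Suc n}"
  proof (rule inj_onI)
    fix i j assume ij: "i \<in> {1..Suc n}" "j \<in> {1..Suc n}" "perm_snoc n \<sigma> i = perm_snoc n \<sigma> j"
    have ne1: "perm_snoc n \<sigma> k \<noteq> 1" if "k \<in> {1..Suc n}" "k \<noteq> Suc n" for k
      using permutes_interval_in[OF assms, of k] that by (simp add: perm_snoc_def)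
    have one: "perm_snoc n \<sigma> (Suc n) = 1" by (simp add: perm_snoc_def)
    show "i = j"
    proof (cases "i = Suc n \<or> j = Suc n")
      case True
      then show ?thesis
        using ij one ne1[of i] ne1[of j] by metis
    next
      case False
      then have "\<sigma> i = \<sigma> j"
        using ij by (simp add: perm_snoc_def)
      then show ?thesis by (rule injD[OF permutes_inj[OF assms]])
    qed
  qed
qed (auto simp: perm_snoc_def)

lemma
  assumes "\<tau> permutes {1..Suc n}" "\<tau> 1 = 1"
  shows permutes_perm_tail: "perm_tail n \<tau> permutes {1..n}"
    and perm_cons_tail: "perm_cons n (perm_tail n \<tau>) = \<tau>"
proof -
  \<comment> \<open>The value 1 is already taken at position 1. All other values are at least 2, so
    the natural-number subtraction in \<open>perm_tail\<close> stays within \<open>{1..n}\<close>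
    and is reversible.\<close>
  have ran: "2 \<le> \<tau> (Suc i) \<and> \<tau> (Suc i) \<le> Suc n" if "i \<in> {1..n}" for i
    using permutes_interval_in[OF assms(1), of "Suc i"] that assms(2)
      injD[OF permutes_inj[OF assms(1)], of "Suc i" 1] by (cases "\<tau> (Suc i) = 1") auto
  show "perm_tail n \<tau> permutes {1..n}"
  proof (rule permutes_intervalI)
    show "perm_tail n \<tau> i \<in> {1..n}" if "i \<in> {1..n}" for i
      using ran[of i] that by (auto simp: perm_tail_def)
    show "inj_on (perm_tail n \<tau>) {1..n}"
    proof (rule inj_onI)
      fix i j assume ij: "i \<in> {1..n}" "j \<in> {1..n}" "perm_tail n \<tau> i = perm_tail n \<tau> j"
      then have "\<tau> (Suc i) = \<tau> (Suc j)"
        using ran[of i] ran[of j] by (auto simp: perm_tail_def)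
      then show "i = j" using injD[OF permutes_inj[OF assms(1)], of "Suc i" "Suc j"] by auto
    qed
  qed (auto simp: perm_tail_def)
  show "perm_cons n (perm_tail n \<tau>) = \<tau>"
  proof
    fix j
    have "j = 1 \<or> (\<exists>i\<in>{1..n}. j = Suc i) \<or> j \<notin> {1..Suc n}"
      by (cases j) (auto simp: Suc_le_eq)
    then show "perm_cons n (perm_tail n \<tau>) j = \<tau> j"
      using assms(2) ran permutes_not_in[OF assms(1), of j]
      by (fastforce simp: perm_cons_def perm_tail_def)
  qed
qed

lemma
  assumes "\<tau> permutes {1..Suc n}" "\<tau> (Suc n) = 1"
  shows permutes_perm_init: "perm_init n \<tau> permutes {1..n}"
    and perm_snoc_init: "perm_snoc n (perm_init n \<tau>) = \<tau>"
proof -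
  have ran: "2 \<le> \<tau> i \<and> \<tau> i \<le> Suc n" if "i \<in> {1..n}" for i
    using permutes_interval_in[OF assms(1), of i] that assms(2)
      injD[OF permutes_inj[OF assms(1)], of i "Suc n"] by (cases "\<tau> i = 1") auto
  show "perm_init n \<tau> permutes {1..n}"
  proof (rule permutes_intervalI)
    show "perm_init n \<tau> i \<in> {1..n}" if "i \<in> {1..n}" for i
      using ran[of i] that by (auto simp: perm_init_def)
    show "inj_on (perm_init n \<tau>) {1..n}"
    proof (rule inj_onI)
      fix i j assume ij: "i \<in> {1..n}" "j \<in> {1..n}" "perm_init n \<tau> i = perm_init n \<tau> j"
      then have "\<tau> i = \<tau> j"
        using ran[of i] ran[of j] by (auto simp: perm_init_def)
      then show "i = j" using injD[OF permutes_inj[OF assms(1)], of i j] by auto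
    qed
  qed (auto simp: perm_init_def)
  show "perm_snoc n (perm_init n \<tau>) = \<tau>"
  proof
    fix j
    show "perm_snoc n (perm_init n \<tau>) j = \<tau> j"
      using assms(2) ran[of j] permutes_not_in[OF assms(1), of j]
      by (auto simp: perm_snoc_def perm_init_def)
  qed
qed

lemma perm_tail_cons: "\<sigma> permutes {1..n} \<Longrightarrow> perm_tail n (perm_cons n \<sigma>) = \<sigma>"
  using permutes_not_in[of \<sigma> "{1..n}"] by (auto simp: perm_tail_def perm_cons_def fun_eq_iff)

lemma perm_init_snoc: "\<sigma> permutes {1..n} \<Longrightarrow> perm_init n (perm_snoc n \<sigma>) = \<sigma>"
  using permutes_not_in[of \<sigma> "{1..n}"] by (auto simp: perm_init_def perm_snoc_def fun_eq_iff)

section \<open>The signed sum as a nested commutator\<close>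

text \<open>For \<open>l \<ge> 1\<close> this is the expansion of
  \<open>[y\<^sub>1, [y\<^sub>2, \<dots>, y\<^sub>l]]\<close> in noncommuting letters, with each
  monomial replaced by the value of \<open>\<Phi>\<close> on its word of indices.\<close>

definition comm_sum :: "nat \<Rightarrow> (nat list \<Rightarrow> 'b::real_vector) \<Rightarrow> 'b" where
  "comm_sum l \<Phi> = (\<Sum>\<sigma> | \<sigma> permutes {1..l}. of_int (perm_coeff l \<sigma>) *\<^sub>R \<Phi> (map \<sigma> [1..<Suc l]))"

lemma comm_sum_diff: "comm_sum l (\<lambda>ys. \<Phi> ys - \<Psi> ys) = comm_sum l \<Phi> - comm_sum l \<Psi>"
  by (simp add: comm_sum_def scaleR_diff_right sum_subtractf)

lemma map_perm_cons: "map (perm_cons n \<sigma>) [1..<Suc (Suc n)] = 1 # map Suc (map \<sigma> [1..<Suc n])"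
proof -
  have "[1..<Suc (Suc n)] = 1 # map Suc [1..<Suc n]"
    by (simp add: map_Suc_upt upt_conv_Cons del: upt_Suc)
  then show ?thesis by (simp add: perm_cons_def del: upt_Suc)
qed

lemma map_perm_snoc: "map (perm_snoc n \<sigma>) [1..<Suc (Suc n)] = map Suc (map \<sigma> [1..<Suc n]) @ [1]"
proof -
  have "[1..<Suc (Suc n)] = [1..<Suc n] @ [Suc n]" by simp
  then show ?thesis by (simp add: perm_snoc_def del: upt_Suc)
qed

text \<open>This is \<open>[y\<^sub>1, C] = y\<^sub>1 C - C y\<^sub>1\<close>, where
  \<open>C\<close> is the nested commutator of the other letters; \<open>map Suc\<close> renumbers
  them.\<close>

lemma comm_sum_Suc:
  assumes "1 \<le> n"
  shows "comm_sum (Suc n) \<Phi> = comm_sum n (\<lambda>ys. \<Phi> (1 # map Suc ys) - \<Phi> (map Suc ys @ [1]))"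
proof -
  obtain k where n: "n = Suc k" using assms by (cases n) auto
  let ?t = "\<lambda>\<tau>. of_int (perm_coeff (Suc n) \<tau>) *\<^sub>R \<Phi> (map \<tau> [1..<Suc (Suc n)])"
  let ?P = "{\<tau>. \<tau> permutes {1..Suc n}}" and ?Q = "{\<sigma>. \<sigma> permutes {1..n}}"
  let ?A = "{\<tau> \<in> ?P. \<tau> 1 = 1}" and ?B = "{\<tau> \<in> ?P. \<tau> (Suc n) = 1}"
  have fin: "finite ?P" by (simp add: finite_permutations)
  have disj: "?A \<inter> ?B = {}"
  proof -
    have False if "\<tau> permutes {1..Suc n}" "\<tau> 1 = 1" "\<tau> (Suc n) = 1" for \<tau>
      using injD[OF permutes_inj[OF that(1)], of 1 "Suc n"] that(2,3) assms by simp
    then show ?thesis by blast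
  qed
  have coeff: "perm_coeff (Suc n) \<tau> = (if \<tau> 1 = 1 then perm_coeff n (perm_tail n \<tau>)
      else if \<tau> (Suc n) = 1 then - perm_coeff n (perm_init n \<tau>) else 0)" for \<tau>
    by (simp add: n perm_tail_def perm_init_def)
  \<comment> \<open>Permutations with the value 1 strictly inside have coefficient 0.\<close>
  have "(\<Sum>\<tau>\<in>?P. ?t \<tau>) = (\<Sum>\<tau>\<in>?A \<union> ?B. ?t \<tau>)"
    by (rule sum.mono_neutral_right) (use fin in \<open>auto simp: coeff\<close>)
  also have "\<dots> = (\<Sum>\<tau>\<in>?A. ?t \<tau>) + (\<Sum>\<tau>\<in>?B. ?t \<tau>)"
    by (rule sum.union_disjoint) (use fin disj in auto)
  also have "(\<Sum>\<tau>\<in>?A. ?t \<tau>) = comm_sum n (\<lambda>ys. \<Phi> (1 # map Suc ys))"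
    unfolding comm_sum_def
  proof (rule sum.reindex_bij_witness[where i = "perm_cons n" and j = "perm_tail n"])
    fix \<tau> assume "\<tau> \<in> ?A"
    then have \<tau>: "\<tau> permutes {1..Suc n}" "\<tau> 1 = 1" by auto
    show "perm_cons n (perm_tail n \<tau>) = \<tau>" by (rule perm_cons_tail[OF \<tau>])
    show "perm_tail n \<tau> \<in> ?Q" using permutes_perm_tail[OF \<tau>] by simp
    show "of_int (perm_coeff n (perm_tail n \<tau>)) *\<^sub>R \<Phi> (1 # map Suc (map (perm_tail n \<tau>) [1..<Suc n])) = ?t \<tau>"
      using \<tau>(2) by (simp only: coeff map_perm_cons[symmetric] perm_cons_tail[OF \<tau>] if_True simp_thms)
  next
    fix \<sigma> assume "\<sigma> \<in> ?Q"
    then have \<sigma>: "\<sigma> permutes {1..n}" by simp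
    show "perm_tail n (perm_cons n \<sigma>) = \<sigma>" by (rule perm_tail_cons[OF \<sigma>])
    show "perm_cons n \<sigma> \<in> ?A" using permutes_perm_cons[OF \<sigma>] by (simp add: perm_cons_def)
  qed
  also have "(\<Sum>\<tau>\<in>?B. ?t \<tau>) = - comm_sum n (\<lambda>ys. \<Phi> (map Suc ys @ [1]))"
    unfolding comm_sum_def sum_negf[symmetric]
  proof (rule sum.reindex_bij_witness[where i = "perm_snoc n" and j = "perm_init n"])
    fix \<tau> assume "\<tau> \<in> ?B"
    \<comment> \<open>\<open>perm_coeff\<close> tests the first position first, so
      \<open>\<tau> 1 \<noteq> 1\<close> selects the branch with the minus sign.\<close>
    then have \<tau>: "\<tau> permutes {1..Suc n}" "\<tau> (Suc n) = 1" and "\<tau> 1 \<noteq> 1" using disj by auto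
    show "perm_snoc n (perm_init n \<tau>) = \<tau>" by (rule perm_snoc_init[OF \<tau>])
    show "perm_init n \<tau> \<in> ?Q" using permutes_perm_init[OF \<tau>] by simp
    show "- (of_int (perm_coeff n (perm_init n \<tau>)) *\<^sub>R \<Phi> (map Suc (map (perm_init n \<tau>) [1..<Suc n]) @ [1])) = ?t \<tau>"
      using \<tau>(2) \<open>\<tau> 1 \<noteq> 1\<close>
      by (simp only: coeff map_perm_snoc[symmetric] perm_snoc_init[OF \<tau>] if_True if_False simp_thms
          of_int_minus scaleR_minus_left)
  next
    fix \<sigma> assume "\<sigma> \<in> ?Q"
    then have \<sigma>: "\<sigma> permutes {1..n}" by simp
    show "perm_init n (perm_snoc n \<sigma>) = \<sigma>" by (rule perm_init_snoc[OF \<sigma>])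
    show "perm_snoc n \<sigma> \<in> ?B" using permutes_perm_snoc[OF \<sigma>] by (simp add: perm_snoc_def)
  qed
  finally show ?thesis
    unfolding comm_sum_diff by (simp add: comm_sum_def)
qed

text \<open>\<open>G\<close> stays arbitrary in the induction because removing the letter 1 leaves
  the new functions \<open>G (1 # map Suc ys)\<close> and \<open>G (map Suc ys @ [1])\<close> of
  \<open>q = p - 1\<close> letters.\<close>

lemma comm_sum_subword_sum:
  assumes "2 \<le> l" "p < l"
  shows "comm_sum l (\<lambda>ys. subword_sum ys p G) = 0"
  using assms
proof (induction l arbitrary: p G rule: nat_induct_at_least)
  case base
  then have "p = 0 \<or> p = 1" by auto
  \<comment> \<open>The words 12 and 21 have the same subwords of length at most one, so their
    contributions cancel.\<close>
  then have "comm_sum (Suc 1) (\<lambda>ys. subword_sum ys p G) = 0"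
    by (subst comm_sum_Suc) (auto simp: comm_sum_def add_ac)
  then show ?case by (simp add: numeral_2_eq_2)
next
  case (Suc l)
  show ?case
  proof (cases p)
    case 0
    with Suc.hyps show ?thesis
      by (subst comm_sum_Suc) (simp_all add: comm_sum_def)
  next
    case (Suc q)
    with Suc.prems have "q < l" by simp
    \<comment> \<open>The subwords of length \<open>Suc q\<close> that avoid 1 cancel between the
      two ends; the two remaining sums of length \<open>q < l\<close> vanish by induction.\<close>
    with Suc Suc.hyps show ?thesis
      by (subst comm_sum_Suc)
        (simp_all add: subword_sum_snoc subword_sum_map comm_sum_diff Suc.IH)
  qed
qed

section \<open>Application to the commutators\<close>

lemma power_word_cong:
  assumes "\<And>k. k \<in> {1..p} \<Longrightarrow> \<sigma> (i k) = \<sigma>' (i' k)"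
  shows "power_word \<sigma> v b i p = power_word \<sigma>' v b i' p"
  using assms by (induction p) (simp_all add: perm_letter_def)

theorem proposition3p7:
  fixes s m l p :: nat
    and f :: "nat \<Rightarrow> real^'n \<Rightarrow> real^'n"
    and b :: "nat \<Rightarrow> nat"
    and v w :: "nat list"
    and x :: "real^'n"
  assumes "1 \<le> s"
    and "\<And>j. j \<in> {1..m} \<Longrightarrow> C_k1_loc m f (s - 1) (f j)"
    and "\<And>j. j \<in> {1..m} \<Longrightarrow> C1 (f j)"
    and "l \<in> {2..s}" and "1 \<le> p" and "p \<le> l - 1"
    and "w \<in> words m"
    and "v \<in> words m" and "length v = l"
    and "1 \<le> (\<Sum>k=1..p. b k)" and "(\<Sum>k=1..p. b k) + length w \<le> s"
  shows "(\<Sum>\<sigma> | \<sigma> permutes {1..l}. of_int (perm_coeff l \<sigma>) *\<^sub>R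
            (\<Sum>i\<in>incr_indices p l. commutator f (power_word \<sigma> v b i p @ w) x)) = 0"
proof -
  \<comment> \<open>The power word depends on \<open>\<sigma>\<close> and \<open>i\<close> only
    through the list of values \<open>\<sigma> (i k)\<close>. Here \<open>ys\<close> is that list,
    read with \<open>id\<close> as index tuple; \<open>k - 1\<close> converts positions from 1 to
    list indices from 0.\<close>
  define G where "G ys = commutator f (power_word (\<lambda>k. ys ! (k - 1)) v b id p @ w) x" for ys
  have G: "commutator f (power_word \<sigma> v b i p @ w) x = G (map (\<lambda>k. \<sigma> (i k)) [1..<Suc p])" for \<sigma> i
    unfolding G_def
    by (subst power_word_cong[where \<sigma>' = "\<lambda>k. map (\<lambda>k. \<sigma> (i k)) [1..<Suc p] ! (k - 1)" and i' = id])
      (auto simp del: upt_Suc)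
  show ?thesis
    using comm_sum_subword_sum[of l p G] assms(4,6)
    by (simp only: G sum_incr_indices comm_sum_def) auto
qed

end
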